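(* $\mathrm{extr}(\mathcal{L}_{ij}^+)\subseteq\mathcal{U}_{ij}^{+1}\cup\mathcal{U}_{ij}^{+2}\cup\mathcal{U}_{ij}^{+3}\cup\mathcal{U}_{ij}^{+4}\cup\mathcal{U}_{ij}^{+5}$, where $\mathcal{L}_{ij}^+$ is defined in the context and $$\mathcal{U}_{ij}^{+1}:=\{(\pi_i,\pi_j,0,0,1)\in\mathbb{R}^5:(\pi_i,\pi_j)\in\Pi_{ij}\},$$ $$\mathcal{U}_{ij}^{+2}:=\{(\underline\pi_i,\pi_j,\bar f_{ij},l_{ij},1)\in\mathbb{R}^5: l_{ij}=H_{ij}\bar f_{ij}((\pi_j/\underline\pi_i)^{\hat\kappa}-1),\ \max\{\underline\pi_j,\underline\pi_i\underline r_{ij}\}\le\pi_j\le\min\{\bar\pi_j,\underline\pi_i\bar r_{ij}\}\},$$ $$\mathcal{U}_{ij}^{+3}:=\{(\bar\pi_i,\pi_j,\bar f_{ij},l_{ij},1)\in\mathbb{R}^5: l_{ij}=H_{ij}\bar f_{ij}((\pi_j/\bar\pi_i)^{\hat\kappa}-1),\ \max\{\underline\pi_j,\bar\pi_i\underline r_{ij}\}\le\pi_j\le\min\{\bar\pi_j,\bar\pi_i\bar r_{ij}\}\},$$ $$\mathcal{U}_{ij}^{+4}:=\{(\pi_i,\underline\pi_j,\bar f_{ij},l_{ij},1)\in\mathbb{R}^5: l_{ij}=H_{ij}\bar f_{ij}((\underline\pi_j/\pi_i)^{\hat\kappa}-1),\ \max\{\underline\pi_i,\underline\pi_j/\bar r_{ij}\}\le\pi_i\le\min\{\bar\pi_i,\underline\pi_j/\underline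 r_{ij}\}\},$$ $$\mathcal{U}_{ij}^{+5}:=\{(\pi_i,\bar\pi_j,\bar f_{ij},l_{ij},1)\in\mathbb{R}^5: l_{ij}=H_{ij}\bar f_{ij}((\bar\pi_j/\pi_i)^{\hat\kappa}-1),\ \max\{\underline\pi_i,\bar\pi_j/\bar r_{ij}\}\le\pi_i\le\min\{\bar\pi_i,\bar\pi_j/\underline r_{ij}\}\}.$$
   Context: Data: real numbers $0<\underline{\pi}_i\le\bar{\pi}_i$, $0<\underline{\pi}_j\le\bar{\pi}_j$, $\bar f_{ij}>0$, $1<\underline r_{ij}<\bar r_{ij}$, $H_{ij}>0$, $\hat\kappa\in(0,1)$. Define $$\Pi_{ij} := \{(\pi_i, \pi_j) \in [\underline{\pi}_{i}, \bar{\pi}_{i}]\times [\underline{\pi}_{j}, \bar{\pi}_{j}] : \underline{r}_{ij} \le \pi_j/\pi_i \le \bar{r}_{ij}\},$$ $$\mathcal{L}_{ij}^+ := \{ (\pi_i, \pi_j, f_{ij}, l_{ij}, x_{ij}) \in \mathbb{R}^4 \times \{1\}: l_{ij} = H_{ij}((\pi_{j}/\pi_{i})^{\hat{\kappa}} -1) f_{ij},\ (\pi_i, \pi_j) \in \Pi_{ij},\ f_{ij} \in [0, \bar{f}_{ij}] \}.$$ For a (possibly nonconvex) set $X$, $\mathrm{extr}(X)$ is the set of points of $X$ that are not of the form $\theta y'+(1-\theta)y''$ with $y',y''\in X$ distinct and $\theta\in(0,1)$. *)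

theory Defs
  imports "HOL-Analysis.Analysis"
begin

text \<open>
  Parameter names: \<open>pil\<close>, \<open>piu\<close> are the lower and upper bounds on \<open>\<pi>\<^sub>i\<close>, \<open>pjl\<close>, \<open>pju\<close> those on
  \<open>\<pi>\<^sub>j\<close>, \<open>rl\<close>, \<open>ru\<close> those on the ratio \<open>\<pi>\<^sub>j / \<pi>\<^sub>i\<close>, \<open>fu\<close> is the upper bound on \<open>f\<^sub>i\<^sub>j\<close>, \<open>H\<close> is \<open>H\<^sub>i\<^sub>j\<close>
  and \<open>\<kappa>\<close> is the exponent. A point of five-dimensional space is a tuple
  \<open>(\<pi>\<^sub>i, \<pi>\<^sub>j, f\<^sub>i\<^sub>j, l\<^sub>i\<^sub>j, x\<^sub>i\<^sub>j)\<close>.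
\<close>

type_synonym real5 = "real \<times> real \<times> real \<times> real \<times> real"

text \<open>
  The predicate \<open>extreme_point_of\<close> is meaningful for nonconvex sets: it uses the open segments
  between points of \<open>X\<close>, which are empty when the endpoints coincide, and does not require
  these segments to lie in \<open>X\<close>.
\<close>

definition extr :: "'a::real_vector set \<Rightarrow> 'a set" where
  "extr X = {y. y extreme_point_of X}"

definition Pi_set :: "real \<Rightarrow> real \<Rightarrow> real \<Rightarrow> real \<Rightarrow> real \<Rightarrow> real \<Rightarrow> (real \<times> real) set" where
  "Pi_set pil piu pjl pju rl ru =
     {(p, q). (p, q) \<in> {pil..piu} \<times> {pjl..pju} \<and> rl \<le> q / p \<and> q / p \<le> ru}"

definition L_plus ::
  "real \<Rightarrow> real \<Rightarrow> real \<Rightarrow> real \<Rightarrow> real \<Rightarrow> real \<Rightarrow> real \<Rightarrow> real \<Rightarrow> real \<Rightarrow> real5 set" where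
  "L_plus pil piu pjl pju rl ru fu H \<kappa> =
     {(p, q, f, l, x). x = 1 \<and> l = H * ((q / p) powr \<kappa> - 1) * f \<and>
        (p, q) \<in> Pi_set pil piu pjl pju rl ru \<and> f \<in> {0..fu}}"

definition U1 :: "real \<Rightarrow> real \<Rightarrow> real \<Rightarrow> real \<Rightarrow> real \<Rightarrow> real \<Rightarrow> real5 set" where
  "U1 pil piu pjl pju rl ru =
     {(p, q, 0, 0, 1) | p q. (p, q) \<in> Pi_set pil piu pjl pju rl ru}"

definition U2 ::
  "real \<Rightarrow> real \<Rightarrow> real \<Rightarrow> real \<Rightarrow> real \<Rightarrow> real \<Rightarrow> real \<Rightarrow> real \<Rightarrow> real5 set" where
  "U2 pil pjl pju rl ru fu H \<kappa> =
     {(pil, q, fu, l, 1) | q l. l = H * fu * ((q / pil) powr \<kappa> - 1) \<and>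
        max pjl (pil * rl) \<le> q \<and> q \<le> min pju (pil * ru)}"

definition U3 ::
  "real \<Rightarrow> real \<Rightarrow> real \<Rightarrow> real \<Rightarrow> real \<Rightarrow> real \<Rightarrow> real \<Rightarrow> real \<Rightarrow> real5 set" where
  "U3 piu pjl pju rl ru fu H \<kappa> =
     {(piu, q, fu, l, 1) | q l. l = H * fu * ((q / piu) powr \<kappa> - 1) \<and>
        max pjl (piu * rl) \<le> q \<and> q \<le> min pju (piu * ru)}"

definition U4 ::
  "real \<Rightarrow> real \<Rightarrow> real \<Rightarrow> real \<Rightarrow> real \<Rightarrow> real \<Rightarrow> real \<Rightarrow> real \<Rightarrow> real5 set" where
  "U4 pil piu pjl rl ru fu H \<kappa> =
     {(p, pjl, fu, l, 1) | p l. l = H * fu * ((pjl / p) powr \<kappa> - 1) \<and>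
        max pil (pjl / ru) \<le> p \<and> p \<le> min piu (pjl / rl)}"

definition U5 ::
  "real \<Rightarrow> real \<Rightarrow> real \<Rightarrow> real \<Rightarrow> real \<Rightarrow> real \<Rightarrow> real \<Rightarrow> real \<Rightarrow> real5 set" where
  "U5 pil piu pju rl ru fu H \<kappa> =
     {(p, pju, fu, l, 1) | p l. l = H * fu * ((pju / p) powr \<kappa> - 1) \<and>
        max pil (pju / ru) \<le> p \<and> p \<le> min piu (pju / rl)}"

end

theory Submission
  imports Defs
begin

text \<open>
  A point of \<open>\<L>\<^sub>i\<^sub>j\<^sup>+\<close> is not extreme if it is the midpoint of a nontrivial segment with both
  endpoints in \<open>\<L>\<^sub>i\<^sub>j\<^sup>+\<close>. For fixed \<open>(\<pi>\<^sub>i, \<pi>\<^sub>j)\<close> the set is a segment in \<open>(f, l)\<close>, which rules out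
  \<open>0 < f < fu\<close>. Since \<open>l\<close> depends on \<open>(\<pi>\<^sub>i, \<pi>\<^sub>j)\<close> only through the ratio \<open>\<pi>\<^sub>j / \<pi>\<^sub>i\<close>, scaling
  \<open>(\<pi>\<^sub>i, \<pi>\<^sub>j)\<close> by \<open>1 \<plusminus> e\<close> rules out points where neither \<open>\<pi>\<^sub>i\<close> nor \<open>\<pi>\<^sub>j\<close> is at a bound.
\<close>

text \<open>Extremality tests only the endpoints for membership in \<open>X\<close>, so a symmetric
  perturbation by \<open>d\<close> suffices even when the segment between them leaves
  \<open>X\<close>.\<close>

lemma not_extr_if_midpoint:
  fixes y d :: "'a::real_vector"
  assumes "y - d \<in> X" "y + d \<in> X" "d \<noteq> 0"
  shows "y \<notin> extr X"
proof -
  have "y - d \<noteq> y + d"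
  proof
    assume "y - d = y + d"
    then have "2 *\<^sub>R d = 0"
      by (simp add: scaleR_2 algebra_simps)
    with assms(3) show False by simp
  qed
  then have "midpoint (y - d) (y + d) \<in> open_segment (y - d) (y + d)"
    by simp
  moreover have "midpoint (y - d) (y + d) = y"
    by (simp add: midpoint_def flip: scaleR_2)
  ultimately show ?thesis
    using assms(1,2) by (auto simp: extr_def extreme_point_of_def)
qed

lemma scaling_margin:
  fixes a b p :: real
  assumes "0 < a" "a < p" "p < b"
  obtains e where "0 < e" "e < 1"
    and "\<And>t. \<bar>t\<bar> \<le> e \<Longrightarrow> a \<le> (1 + t) * p \<and> (1 + t) * p \<le> b"
proof
  have p: "0 < p" using assms by linarith
  \<comment> \<open>Relative distances from \<open>p\<close> to the two bounds; the first is below 1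
    because \<open>a / p\<close> is positive.\<close>
  let ?e = "min (1 - a / p) (b / p - 1)"
  show "0 < ?e" "?e < 1"
    using assms p by (auto simp: min_less_iff_disj)
  fix t :: real assume "\<bar>t\<bar> \<le> ?e"
  then have "a / p \<le> 1 + t" "1 + t \<le> b / p" by linarith+
  with p show "a \<le> (1 + t) * p \<and> (1 + t) * p \<le> b"
    by (simp add: pos_divide_le_eq pos_le_divide_eq)
qed

lemma L_plus_interior_flow_not_extr:
  assumes mem: "(p, q, f, l, x) \<in> L_plus pil piu pjl pju rl ru fu H \<kappa>"
    and f: "0 < f" "f < fu"
  shows "(p, q, f, l, x) \<notin> extr (L_plus pil piu pjl pju rl ru fu H \<kappa>)"
proof (rule not_extr_if_midpoint)
  define e where "e = min f (fu - f)"
  have e: "0 < e" "e \<le> f" "f + e \<le> fu" using f by (auto simp: e_def)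
  \<comment> \<open>With the pressures fixed, \<open>l\<close> is linear in \<open>f\<close>; the
    fourth entry is its slope times \<open>e\<close>, so the defining equation survives.\<close>
  let ?d = "(0, 0, e, H * ((q / p) powr \<kappa> - 1) * e, 0) :: real5"
  show "(p, q, f, l, x) - ?d \<in> L_plus pil piu pjl pju rl ru fu H \<kappa>"
    "(p, q, f, l, x) + ?d \<in> L_plus pil piu pjl pju rl ru fu H \<kappa>"
    using mem e by (auto simp: L_plus_def algebra_simps)
  show "?d \<noteq> 0" using e by (simp add: zero_prod_def)
qed

lemma L_plus_interior_pressures_not_extr:
  assumes mem: "(p, q, f, l, x) \<in> L_plus pil piu pjl pju rl ru fu H \<kappa>"
    and p: "0 < pil" "pil < p" "p < piu"
    and q: "0 < pjl" "pjl < q" "q < pju"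
  shows "(p, q, f, l, x) \<notin> extr (L_plus pil piu pjl pju rl ru fu H \<kappa>)"
proof -
  obtain e1 where e1: "0 < e1" "e1 < 1"
    "\<And>t. \<bar>t\<bar> \<le> e1 \<Longrightarrow> pil \<le> (1 + t) * p \<and> (1 + t) * p \<le> piu"
    using scaling_margin[OF p] by blast
  obtain e2 where e2: "0 < e2" "e2 < 1"
    "\<And>t. \<bar>t\<bar> \<le> e2 \<Longrightarrow> pjl \<le> (1 + t) * q \<and> (1 + t) * q \<le> pju"
    using scaling_margin[OF q] by blast
  \<comment> \<open>Both pressures must be scaled by the same factor to preserve their ratio, hence
    a common margin.\<close>
  define e where "e = min e1 e2"
  have scaled: "((1 + t) * p, (1 + t) * q, f, l, x) \<in> L_plus pil piu pjl pju rl ru fu H \<kappa>"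
    if t: "\<bar>t\<bar> \<le> e" for t
  proof -
    \<comment> \<open>A margin below 1 keeps the factor positive, so it cancels in the
      ratio.\<close>
    have "1 + t \<noteq> 0" using t e1(2) by (auto simp: e_def)
    then have "(1 + t) * q / ((1 + t) * p) = q / p" by simp
    then show ?thesis
      using mem e1(3)[of t] e2(3)[of t] t by (auto simp: L_plus_def Pi_set_def e_def)
  qed
  let ?d = "(e * p, e * q, 0, 0, 0) :: real5"
  have e: "0 < e" using e1 e2 by (simp add: e_def)
  have "(p, q, f, l, x) - ?d \<in> L_plus pil piu pjl pju rl ru fu H \<kappa>"
    "(p, q, f, l, x) + ?d \<in> L_plus pil piu pjl pju rl ru fu H \<kappa>"
    using scaled[of "- e"] scaled[of e] e by (simp_all add: algebra_simps)
  moreover have "?d \<noteq> 0" using e p by (simp add: zero_prod_def)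
  ultimately show ?thesis by (rule not_extr_if_midpoint)
qed

theorem proposition3:
  fixes pil piu pjl pju rl ru fu H \<kappa> :: real
  assumes "0 < pil" and "pil \<le> piu"
    and "0 < pjl" and "pjl \<le> pju"
    and "0 < fu"
    and "1 < rl" and "rl < ru"
    and "0 < H"
    and "0 < \<kappa>" and "\<kappa> < 1"
  shows "extr (L_plus pil piu pjl pju rl ru fu H \<kappa>) \<subseteq>
    U1 pil piu pjl pju rl ru \<union>
    U2 pil pjl pju rl ru fu H \<kappa> \<union>
    U3 piu pjl pju rl ru fu H \<kappa> \<union>
    U4 pil piu pjl rl ru fu H \<kappa> \<union>
    U5 pil piu pju rl ru fu H \<kappa>"
proof
  let ?L = "L_plus pil piu pjl pju rl ru fu H \<kappa>"
  fix y assume y: "y \<in> extr ?L"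
  obtain p q f l x where y_eq: "y = (p, q, f, l, x)" by (metis prod.exhaust)
  have mem: "(p, q, f, l, x) \<in> ?L"
    using y by (simp add: y_eq extr_def extreme_point_of_def)
  then have x: "x = 1" and l: "l = H * ((q / p) powr \<kappa> - 1) * f"
    and box: "pil \<le> p" "p \<le> piu" "pjl \<le> q" "q \<le> pju"
    and ratio: "rl \<le> q / p" "q / p \<le> ru"
    and f: "0 \<le> f" "f \<le> fu"
    by (auto simp: L_plus_def Pi_set_def)
  have p_pos: "0 < p" using box assms by linarith
  have rl_pos: "0 < rl" and ru_pos: "0 < ru" using assms by linarith+
  \<comment> \<open>The ratio constraint is solved for \<open>q\<close> as needed in
    \<open>U2\<close> and \<open>U3\<close>, then for \<open>p\<close> as needed in
    \<open>U4\<close> and \<open>U5\<close>.\<close>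
  have q_bounds: "p * rl \<le> q" "q \<le> p * ru"
    using ratio p_pos by (simp_all add: field_simps)
  then have p_bounds: "q / ru \<le> p" "p \<le> q / rl"
    using rl_pos ru_pos by (simp_all add: field_simps)
  have "f = 0 \<or> f = fu"
    using L_plus_interior_flow_not_extr[OF mem] y f by (fastforce simp: y_eq)
  then show "y \<in> U1 pil piu pjl pju rl ru \<union> U2 pil pjl pju rl ru fu H \<kappa> \<union>
    U3 piu pjl pju rl ru fu H \<kappa> \<union> U4 pil piu pjl rl ru fu H \<kappa> \<union> U5 pil piu pju rl ru fu H \<kappa>"
  proof
    assume "f = 0"
    then have "y \<in> U1 pil piu pjl pju rl ru"
      using x l box ratio by (simp add: y_eq U1_def Pi_set_def)
    then show ?thesis by blast
  next
    assume fu: "f = fu"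
    then have l': "l = H * fu * ((q / p) powr \<kappa> - 1)" using l by simp
    have "p = pil \<or> p = piu \<or> q = pjl \<or> q = pju"
      using L_plus_interior_pressures_not_extr[OF mem] y box assms(1,3)
      by (fastforce simp: y_eq)
    then consider "p = pil" | "p = piu" | "q = pjl" | "q = pju" by blast
    then show ?thesis
    proof cases
      case 1
      then have "y \<in> U2 pil pjl pju rl ru fu H \<kappa>"
        using x fu l' box q_bounds by (simp add: y_eq U2_def)
      then show ?thesis by blast
    next
      case 2
      then have "y \<in> U3 piu pjl pju rl ru fu H \<kappa>"
        using x fu l' box q_bounds by (simp add: y_eq U3_def)
      then show ?thesis by blast
    next
      case 3
      then have "y \<in> U4 pil piu pjl rl ru fu H \<kappa>"
        using x fu l' box p_bounds by (simp add: y_eq U4_def)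
      then show ?thesis by blast
    next
      case 4
      then have "y \<in> U5 pil piu pju rl ru fu H \<kappa>"
        using x fu l' box p_bounds by (simp add: y_eq U5_def)
      then show ?thesis by blast
    qed
  qed
qed

end
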